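(* Consider the uncertain plant described in the context, satisfying (i) box uncertainty, (ii) bounded nonlinearity and (iii) existence of an equilibrium, in closed loop with the controller $$\dot w(t)=B_c\big(y(t)-y^{\rm d}\big),\qquad u(t)=C_c w(t)+D_c\big(y(t)-y^{\rm d}\big).$$ Consider the optimization program of maximizing $\alpha\zeta^{-1}$ over $\alpha\in\mathbb{R}$, $\zeta>0$, $\kappa_{ij}>0$ ($1\le i,j\le n_x$), $\mu_{ik}>0$ ($1\le i\le n_x$, $1\le k\le n_u$), symmetric positive definite $P\in\mathbb{R}^{(n_x+n_u)\times(n_x+n_u)}$, $C_c\in\mathbb{R}^{n_u\times n_u}$ and $B_c,D_c\in\mathbb{R}^{n_u\times n_y}$, subject to $$\begin{bmatrix} M+\sum_{i,j}\kappa_{ij}J^\top e_je_j^\top J & * & * & * & *\\ H_1^\top & G_1 & * & * & *\\ \tilde H_1^\top & 0 & G_2 & * & *\\ H_2^\top & 0 & 0 & G_3 & *\\ JP & 0&0&0&-\zeta I \end{bmatrix}\preceq 0,$$ where the matrices $M,H_1,\tilde H_1,H_2,G_1,G_2,G_3,J$ are defined in the context. Let $\alpha_*,\zeta_*,P_*$ denote the values of the corresponding decision variables at an optimal solution, and let the controller use the corresponding optimal $B_c,C_c,D_c$. If $\alpha_*>0$, then the controller provides $\varepsilon_{\rm c}$-practical output regulation, i.e. $$\sup_{t\ge0}\|x(t)\|<\infty,\qquad \limsup_{t\to\infty}\|y(t)-y^{\rm d}\|\le\varepsilon_{\rm c}\qquad\text{for all }x(0)\in\mathbb{R}^{n_x},$$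 where $$\varepsilon_{\rm c}=k_b\|\bar C\|\sqrt{\frac{\lambda_{\max}(P_* )}{\alpha_*\zeta_*^{-1}\lambda_{\min}(P_* )}}.$$ In particular, if $k_b=0$ and $\alpha_*>0$, then the closed-loop system is exponentially stable and $\lim_{t\to\infty}y(t)=y^{\rm d}$.
   Context: Plant: $\dot x(t)=A^\star x(t)+B^\star u(t)+k^\star(x(t))$, $y(t)=Cx(t)$, with $x(t)\in\mathbb{R}^{n_x}$, $u(t)\in\mathbb{R}^{n_u}$, $y(t)\in\mathbb{R}^{n_y}$; it is assumed throughout that the system admits a unique solution $x(\cdot)$ for any $x(0)$. $A^\star,B^\star,k^\star$ are uncertain, and $y^{\rm d}\in\mathbb{R}^{n_y}$ is a desired output value. Assumptions: (i) Box uncertainty: $|A^\star-A|\le A_b$, $|B^\star-B|\le B_b$, where $A,B$ are known nominal matrices, $A_b=[a_{b_{ij}}]$, $B_b=[b_{b_{ik}}]$ are known uncertainty bounds (entries positive, as their inverses are used), and absolute values and inequalities are element-wise. (ii) Bounded nonlinearity: $\|k^\star(x_1)-k^\star(x_2)\|\le k_b$ for all $x_1,x_2\in\mathbb{R}^{n_x}$, where $k_b\ge0$ is a known constant. (iii) There exists $(x^{\rm d},u^{\rm d})\in\mathbb{R}^{n_x}\times\mathbb{R}^{n_u}$ with $y^{\rm d}=Cx^{\rm d}$ and $A^\star x^{\rm d}+k^\star(x^{\rm d})=-B^\star u^{\rm d}$. Notation: $w(t)\in\mathbb{R}^{n_u}$ is the controller state. $[X]^\dagger=X+X^\top$; $\preceq$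 is the semidefinite order; $*$ denotes blocks determined by symmetry; $\|\cdot\|$ is the Euclidean norm and the induced matrix norm; $\lambda_{\min},\lambda_{\max}$ are the extreme eigenvalues; $e_1,e_2,\dots$ are standard basis column vectors (of the appropriate dimension); $$\bar A=\begin{bmatrix}A&0\\0&0\end{bmatrix}\in\mathbb{R}^{(n_x+n_u)\times(n_x+n_u)},\quad \bar B=\begin{bmatrix}B&0\\0&I_{n_u}\end{bmatrix},\quad \bar C=\begin{bmatrix}C&0\\0&I_{n_u}\end{bmatrix},\quad F=\begin{bmatrix}D_c&C_c\\ B_c&0\end{bmatrix},$$ $$J=\begin{bmatrix}I_{n_x}&0_{n_x\times n_u}\end{bmatrix},\quad J_u=\begin{bmatrix}I_{n_u}&0_{n_u\times n_u}\end{bmatrix},\quad M=[P\bar A+P\bar BF\bar C]^\dagger+\alpha I.$$ $G_1$ is the diagonal matrix with entries $-\kappa_{ij}a_{b_{ij}}^{-2}$ indexed by pairs $(i,j)$, $1\le i,j\le n_x$; $G_2$ and $G_3$ are the diagonal matrices with entries $-\mu_{ik}b_{b_{ik}}^{-2}$ and $-\mu_{ik}^{-1}$, respectively, indexed by pairs $(i,k)$, $1\le i\le n_x$, $1\le k\le n_u$. $H_1$ is the matrix whose column of index $(i,j)$ is $PJ^\top e_i$; $\tilde H_1$ is the matrix whose column of index $(i,k)$ is $PJ^\top e_i$; $H_2$ is the matrix whose column of index $(i,k)$ is $\bar C^\top F^\top J_u^\top e_k$ (column orderings matching those of $G_1,G_2,G_3$). *)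

theory Defs
  imports "HOL-Analysis.Analysis"
begin

section \<open>Matrices\<close>

text \<open>
  Sizes of block rows and columns are index types; stacking an \<open>'m\<close>-block on top of
  an \<open>'n\<close>-block gives the index type \<open>'m + 'n\<close>.
\<close>

definition hcat :: "real^('c::finite)^'m \<Rightarrow> real^('d::finite)^'m \<Rightarrow> real^('c + 'd)^'m" where
  "hcat X Y = (\<chi> i j. case j of Inl c \<Rightarrow> X $ i $ c | Inr d \<Rightarrow> Y $ i $ d)"

definition vcat :: "real^'c^('m::finite) \<Rightarrow> real^'c^('n::finite) \<Rightarrow> real^'c^('m + 'n)" where
  "vcat X Y = (\<chi> i. case i of Inl m \<Rightarrow> X $ m | Inr n \<Rightarrow> Y $ n)"

definition block2 ::
  "real^('c::finite)^('m::finite) \<Rightarrow> real^('d::finite)^'m \<Rightarrow>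
   real^'c^('n::finite) \<Rightarrow> real^'d^'n \<Rightarrow> real^('c + 'd)^('m + 'n)" where
  "block2 X Y Z W = vcat (hcat X Y) (hcat Z W)"

definition diag_mat :: "('n::finite \<Rightarrow> real) \<Rightarrow> real^'n^'n" where
  "diag_mat f = (\<chi> i j. if i = j then f i else 0)"

text \<open>\<open>herm X\<close> is $[X]^\dagger = X + X^\top$.\<close>

definition herm :: "real^'n^'n \<Rightarrow> real^'n^'n" where
  "herm X = X + transpose X"

definition sym_pos_def :: "real^'n^'n \<Rightarrow> bool" where
  "sym_pos_def X \<longleftrightarrow> transpose X = X \<and> (\<forall>v. v \<noteq> 0 \<longrightarrow> v \<bullet> (X *v v) > 0)"

definition neg_semidef :: "real^'n^'n \<Rightarrow> bool" where
  "neg_semidef X \<longleftrightarrow> transpose X = X \<and> (\<forall>v. v \<bullet> (X *v v) \<le> 0)"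

definition eigenvalues :: "real^'n^'n \<Rightarrow> real set" where
  "eigenvalues X = {l. \<exists>v. v \<noteq> 0 \<and> X *v v = l *\<^sub>R v}"

text \<open>These are only used for symmetric matrices, whose (finite, nonempty) spectrum is real.\<close>

definition lambda_max :: "real^'n^'n \<Rightarrow> real" where
  "lambda_max X = Max (eigenvalues X)"

definition lambda_min :: "real^'n^'n \<Rightarrow> real" where
  "lambda_min X = Min (eigenvalues X)"

text \<open>The induced (spectral) norm; \<open>norm\<close> on matrices is the Frobenius norm.\<close>

definition induced_norm :: "real^'n^'m \<Rightarrow> real" where
  "induced_norm X = onorm (\<lambda>v. X *v v)"

section \<open>The linear matrix inequality\<close>

definition A_bar :: "real^('nx::finite)^'nx \<Rightarrow> real^('nx + 'nu::finite)^('nx + 'nu)" where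
  "A_bar A = block2 A 0 0 0"

definition B_bar :: "real^('nu::finite)^('nx::finite) \<Rightarrow> real^('nu + 'nu)^('nx + 'nu)" where
  "B_bar B = block2 B 0 0 (mat 1)"

definition C_bar :: "real^('nx::finite)^('ny::finite) \<Rightarrow> real^('nx + 'nu::finite)^('ny + 'nu)" where
  "C_bar C = block2 C 0 0 (mat 1)"

definition F_mat ::
  "real^('ny::finite)^('nu::finite) \<Rightarrow> real^'nu^'nu \<Rightarrow> real^'ny^'nu \<Rightarrow> real^('ny + 'nu)^('nu + 'nu)" where
  "F_mat Bc Cc Dc = block2 Dc Cc Bc 0"

definition J_mat :: "real^('nx::finite + 'nu::finite)^'nx" where
  "J_mat = hcat (mat 1) 0"

definition Ju_mat :: "real^('nu::finite + 'nu)^'nu" where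
  "Ju_mat = hcat (mat 1) 0"

definition M_mat ::
  "real^('nx::finite)^'nx \<Rightarrow> real^('nu::finite)^'nx \<Rightarrow> real^'nx^'ny \<Rightarrow> real \<Rightarrow> real^('nx + 'nu)^('nx + 'nu) \<Rightarrow>
   real^'ny^'nu \<Rightarrow> real^'nu^'nu \<Rightarrow> real^'ny^'nu \<Rightarrow> real^('nx + 'nu)^('nx + 'nu)" where
  "M_mat A B C \<alpha> P Bc Cc Dc =
     herm (P ** A_bar A + P ** B_bar B ** F_mat Bc Cc Dc ** C_bar C) + \<alpha> *\<^sub>R mat 1"

definition G1_mat :: "real^('nx::finite)^'nx \<Rightarrow> real^'nx^'nx \<Rightarrow> real^('nx \<times> 'nx)^('nx \<times> 'nx)" where
  "G1_mat Ab \<kappa> = diag_mat (\<lambda>(i, j). - (\<kappa> $ i $ j * inverse (Ab $ i $ j ^ 2)))"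

definition G2_mat :: "real^('nu::finite)^('nx::finite) \<Rightarrow> real^'nu^'nx \<Rightarrow> real^('nx \<times> 'nu)^('nx \<times> 'nu)" where
  "G2_mat Bb \<mu> = diag_mat (\<lambda>(i, k). - (\<mu> $ i $ k * inverse (Bb $ i $ k ^ 2)))"

definition G3_mat :: "real^('nu::finite)^('nx::finite) \<Rightarrow> real^('nx \<times> 'nu)^('nx \<times> 'nu)" where
  "G3_mat \<mu> = diag_mat (\<lambda>(i, k). - inverse (\<mu> $ i $ k))"

definition H1_mat :: "real^('nx::finite + 'nu::finite)^('nx + 'nu) \<Rightarrow> real^('nx \<times> 'nx)^('nx + 'nu)" where
  "H1_mat P = (\<chi> r c. (P *v (transpose J_mat *v axis (fst c) 1)) $ r)"

definition H1_tilde :: "real^('nx::finite + 'nu::finite)^('nx + 'nu) \<Rightarrow> real^('nx \<times> 'nu)^('nx + 'nu)" where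
  "H1_tilde P = (\<chi> r c. (P *v (transpose J_mat *v axis (fst c) 1)) $ r)"

definition H2_mat ::
  "real^('nx::finite)^'ny \<Rightarrow> real^'ny^('nu::finite) \<Rightarrow> real^'nu^'nu \<Rightarrow> real^'ny^'nu \<Rightarrow>
   real^('nx \<times> 'nu)^('nx + 'nu)" where
  "H2_mat C Bc Cc Dc =
     (\<chi> r c. (transpose (C_bar C) *v (transpose (F_mat Bc Cc Dc) *v
              (transpose Ju_mat *v axis (snd c) 1))) $ r)"

definition kappa_sum :: "real^('nx::finite)^'nx \<Rightarrow> real^('nx + 'nu::finite)^('nx + 'nu)" where
  "kappa_sum \<kappa> = (\<Sum>i\<in>UNIV. \<Sum>j\<in>UNIV. \<kappa> $ i $ j *\<^sub>R
     (transpose J_mat ** (columnvector (axis j 1) :: real^1^'nx) ** rowvector (axis j 1) ** J_mat))"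

text \<open>
  In \<open>lmi_matrix\<close>, \<open>V\<close> collects the off-diagonal blocks $H_1^\top, \tilde H_1^\top, H_2^\top, JP$
  of the first block column; the blocks marked by a star in the first block row are their
  transposes, and all other off-diagonal blocks vanish.
\<close>

definition lmi_matrix ::
  "real^('nx::finite)^'nx \<Rightarrow> real^('nu::finite)^'nx \<Rightarrow> real^'nx^'ny \<Rightarrow> real^'nx^'nx \<Rightarrow> real^'nu^'nx \<Rightarrow>
   real \<Rightarrow> real \<Rightarrow> real^'nx^'nx \<Rightarrow> real^'nu^'nx \<Rightarrow> real^('nx + 'nu)^('nx + 'nu) \<Rightarrow>
   real^'ny^'nu \<Rightarrow> real^'nu^'nu \<Rightarrow> real^'ny^'nu \<Rightarrow>
   real^(('nx + 'nu) + ('nx \<times> 'nx) + ('nx \<times> 'nu) + ('nx \<times> 'nu) + 'nx)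
       ^(('nx + 'nu) + ('nx \<times> 'nx) + ('nx \<times> 'nu) + ('nx \<times> 'nu) + 'nx)" where
  "lmi_matrix A B C Ab Bb \<alpha> \<zeta> \<kappa> \<mu> P Bc Cc Dc =
     (let V = vcat (transpose (H1_mat P))
               (vcat (transpose (H1_tilde P))
                 (vcat (transpose (H2_mat C Bc Cc Dc))
                   (J_mat ** P)))
      in block2 (M_mat A B C \<alpha> P Bc Cc Dc + kappa_sum \<kappa>) (transpose V)
                V (block2 (G1_mat Ab \<kappa>) 0
                          0 (block2 (G2_mat Bb \<mu>) 0
                                    0 (block2 (G3_mat \<mu>) 0
                                              0 (- \<zeta> *\<^sub>R mat 1)))))"

definition feasible ::
  "real^('nx::finite)^'nx \<Rightarrow> real^('nu::finite)^'nx \<Rightarrow> real^'nx^'ny \<Rightarrow> real^'nx^'nx \<Rightarrow> real^'nu^'nx \<Rightarrow>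
   real \<Rightarrow> real \<Rightarrow> real^'nx^'nx \<Rightarrow> real^'nu^'nx \<Rightarrow> real^('nx + 'nu)^('nx + 'nu) \<Rightarrow>
   real^'ny^'nu \<Rightarrow> real^'nu^'nu \<Rightarrow> real^'ny^'nu \<Rightarrow> bool" where
  "feasible A B C Ab Bb \<alpha> \<zeta> \<kappa> \<mu> P Bc Cc Dc \<longleftrightarrow>
     \<zeta> > 0 \<and> (\<forall>i j. \<kappa> $ i $ j > 0) \<and> (\<forall>i k. \<mu> $ i $ k > 0) \<and> sym_pos_def P \<and>
     neg_semidef (lmi_matrix A B C Ab Bb \<alpha> \<zeta> \<kappa> \<mu> P Bc Cc Dc)"

definition optimal ::
  "real^('nx::finite)^'nx \<Rightarrow> real^('nu::finite)^'nx \<Rightarrow> real^'nx^'ny \<Rightarrow> real^'nx^'nx \<Rightarrow> real^'nu^'nx \<Rightarrow>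
   real \<Rightarrow> real \<Rightarrow> real^'nx^'nx \<Rightarrow> real^'nu^'nx \<Rightarrow> real^('nx + 'nu)^('nx + 'nu) \<Rightarrow>
   real^'ny^'nu \<Rightarrow> real^'nu^'nu \<Rightarrow> real^'ny^'nu \<Rightarrow> bool" where
  "optimal A B C Ab Bb \<alpha> \<zeta> \<kappa> \<mu> P Bc Cc Dc \<longleftrightarrow>
     feasible A B C Ab Bb \<alpha> \<zeta> \<kappa> \<mu> P Bc Cc Dc \<and>
     (\<forall>\<alpha>' \<zeta>' \<kappa>' \<mu>' P' Bc' Cc' Dc'.
        feasible A B C Ab Bb \<alpha>' \<zeta>' \<kappa>' \<mu>' P' Bc' Cc' Dc' \<longrightarrow>
        \<alpha>' * inverse \<zeta>' \<le> \<alpha> * inverse \<zeta>)"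

section \<open>Plant, controller and closed loop\<close>

definition plant_rhs ::
  "real^'nx^'nx \<Rightarrow> real^'nu^'nx \<Rightarrow> (real^'nx \<Rightarrow> real^'nx) \<Rightarrow> real^'nx \<Rightarrow> real^'nu \<Rightarrow> real^'nx" where
  "plant_rhs As Bs ks x u = As *v x + Bs *v u + ks x"

definition control_input ::
  "real^'nx^'ny \<Rightarrow> real^'ny \<Rightarrow> real^'nu^'nu \<Rightarrow> real^'ny^'nu \<Rightarrow> real^'nx \<Rightarrow> real^'nu \<Rightarrow> real^'nu" where
  "control_input C yd Cc Dc x w = Cc *v w + Dc *v (C *v x - yd)"

definition closed_loop_rhs ::
  "real^'nx^'nx \<Rightarrow> real^'nu^'nx \<Rightarrow> (real^'nx \<Rightarrow> real^'nx) \<Rightarrow> real^'nx^'ny \<Rightarrow> real^'ny \<Rightarrow>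
   real^'ny^'nu \<Rightarrow> real^'nu^'nu \<Rightarrow> real^'ny^'nu \<Rightarrow>
   (real^'nx) \<times> (real^'nu) \<Rightarrow> (real^'nx) \<times> (real^'nu)" where
  "closed_loop_rhs As Bs ks C yd Bc Cc Dc = (\<lambda>(x, w).
     (plant_rhs As Bs ks x (control_input C yd Cc Dc x w), Bc *v (C *v x - yd)))"

text \<open>Classical solution on $[0,\infty)$ of an autonomous equation (one-sided derivative at \<open>0\<close>).\<close>

definition solution :: "('a::real_normed_vector \<Rightarrow> 'a) \<Rightarrow> (real \<Rightarrow> 'a) \<Rightarrow> bool" where
  "solution f z \<longleftrightarrow> (\<forall>t\<ge>0. (z has_vector_derivative f (z t)) (at t within {0..}))"

text \<open>Uniqueness refers to times \<open>t \<ge> 0\<close> only, since functions here are defined on all reals.\<close>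

definition unique_solutions :: "('a::real_normed_vector \<Rightarrow> 'a) \<Rightarrow> bool" where
  "unique_solutions f \<longleftrightarrow>
     (\<forall>z0. (\<exists>z. solution f z \<and> z 0 = z0) \<and>
           (\<forall>z z'. solution f z \<and> z 0 = z0 \<and> solution f z' \<and> z' 0 = z0 \<longrightarrow> (\<forall>t\<ge>0. z t = z' t)))"

text \<open>Global exponential stability of some equilibrium.\<close>

definition exponentially_stable :: "('a::real_normed_vector \<Rightarrow> 'a) \<Rightarrow> bool" where
  "exponentially_stable f \<longleftrightarrow>
     (\<exists>ze. f ze = 0 \<and>
       (\<exists>c>0. \<exists>r>0. \<forall>z. solution f z \<longrightarrow>
          (\<forall>t\<ge>0. norm (z t - ze) \<le> c * exp (- r * t) * norm (z 0 - ze))))"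

text \<open>Ranging over all solutions covers all \<open>x(0)\<close>; \<open>w(0)\<close> is arbitrary as well.\<close>

definition practical_output_regulation ::
  "real^'nx^'nx \<Rightarrow> real^'nu^'nx \<Rightarrow> (real^'nx \<Rightarrow> real^'nx) \<Rightarrow> real^'nx^'ny \<Rightarrow> real^'ny \<Rightarrow>
   real^'ny^'nu \<Rightarrow> real^'nu^'nu \<Rightarrow> real^'ny^'nu \<Rightarrow> real \<Rightarrow> bool" where
  "practical_output_regulation As Bs ks C yd Bc Cc Dc \<epsilon> \<longleftrightarrow>
     (\<forall>x w. solution (closed_loop_rhs As Bs ks C yd Bc Cc Dc) (\<lambda>t. (x t, w t)) \<longrightarrow>
        bdd_above ((\<lambda>t. norm (x t)) ` {0..}) \<and>
        Limsup at_top (\<lambda>t. ereal (norm (C *v x t - yd))) \<le> ereal \<epsilon>)"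

definition eps_c ::
  "real \<Rightarrow> real^('nx::finite)^'ny \<Rightarrow> real \<Rightarrow> real \<Rightarrow> real^('nx + 'nu::finite)^('nx + 'nu) \<Rightarrow> real" where
  "eps_c kb C \<alpha> \<zeta> P =
     kb * induced_norm (C_bar C :: real^('nx + 'nu)^('ny + 'nu)) *
     sqrt (lambda_max P / (\<alpha> * inverse \<zeta> * lambda_min P))"

end

theory Submission
  imports Defs
begin

text \<open>
  One quadratic Lyapunov function works for all plants in the uncertainty box, and the linear matrix
  inequality is designed to say just that.

  Let \<open>e = (x - xd, w - wd)\<close> be the deviation from a closed-loop equilibrium, where \<open>wd\<close> solves
  \<open>Cc wd = ud\<close>. It obeys a linear equation whose uncertain coefficients lie in the box, driven by
  \<open>d = ks x - ks xd\<close>, which is bounded by \<open>kb\<close>. The semidefinite constraint is an inequality for a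
  quadratic form in \<open>e\<close> and four auxiliary vectors. The first is set to the contributions
  \<open>(As - A)\<^sub>i\<^sub>j e\<^sub>j\<close> of the uncertain entries of \<open>A\<close>, the second to those of the uncertain entries
  of \<open>B\<close>, the third to a weighted copy of the input deviation, which offsets the square terms of the
  second, and the fourth to \<open>d\<close>. With these values (\<open>lmi_dissipation\<close>) the form \<open>V = e \<bullet> P e\<close>
  satisfies
    \<open>V' \<le> - \<alpha> \<parallel>e\<parallel>\<^sup>2 + \<zeta> \<parallel>d\<parallel>\<^sup>2\<close>
  along every solution. The same inequality for states \<open>(0, w)\<close> and \<open>d = 0\<close> shows that \<open>Cc\<close> is
  injective, hence invertible (\<open>controller_output_surj\<close>), which is why \<open>wd\<close> exists.

  Since \<open>V \<le> \<lambda>\<^sub>m\<^sub>a\<^sub>x(P) \<parallel>e\<parallel>\<^sup>2\<close> by the Rayleigh quotient, \<open>V\<close> satisfies a scalar linear differential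
  inequality and is therefore at most \<open>\<zeta> kb\<^sup>2 \<lambda>\<^sub>m\<^sub>a\<^sub>x(P) / \<alpha>\<close> up to an exponentially decaying term
  (\<open>linear_differential_inequality\<close>). Dividing by \<open>\<lambda>\<^sub>m\<^sub>i\<^sub>n(P)\<close> bounds \<open>e\<close>, and the output error is the
  first block of \<open>C_bar C\<close> applied to \<open>e\<close>; the resulting limit is \<open>\<epsilon>\<^sub>c\<close>. With \<open>kb = 0\<close> only the
  exponentially decaying term remains.
\<close>

section \<open>Extreme eigenvalues of symmetric matrices\<close>

lemma inner_matrix_transpose:
  fixes X :: "real^'n::finite^'m::finite"
  shows "x \<bullet> (X *v y) = (transpose X *v x) \<bullet> y"
  by (simp add: dot_lmul_matrix)

lemma symmetric_inner_commute:
  fixes X :: "real^'n::finite^'n"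
  assumes "transpose X = X"
  shows "x \<bullet> (X *v y) = (X *v x) \<bullet> y"
  using inner_matrix_transpose[of x X y] assms by simp

text \<open>
  Eigenvectors for distinct eigenvalues are orthogonal, and a finite-dimensional space has no
  infinite orthogonal family.
\<close>

lemma finite_eigenvalues_symmetric:
  fixes X :: "real^'n::finite^'n"
  assumes sym: "transpose X = X"
  shows "finite (eigenvalues X)"
proof -
  define ev where "ev l = (SOME v. v \<noteq> 0 \<and> X *v v = l *\<^sub>R v)" for l
  have ev: "ev l \<noteq> 0 \<and> X *v ev l = l *\<^sub>R ev l" if "l \<in> eigenvalues X" for l
    unfolding ev_def by (rule someI_ex) (use that in \<open>simp add: eigenvalues_def\<close>)
  have orth: "ev l \<bullet> ev m = 0" if "l \<in> eigenvalues X" "m \<in> eigenvalues X" "l \<noteq> m" for l m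
  proof -
    have "m * (ev l \<bullet> ev m) = l * (ev l \<bullet> ev m)"
      using symmetric_inner_commute[OF sym, of "ev l" "ev m"]
      by (simp only: conjunct2[OF ev[OF that(1)]] conjunct2[OF ev[OF that(2)]] inner_scaleR_left
          inner_scaleR_right)
    thus ?thesis using that(3) by simp
  qed
  have "inj_on ev (eigenvalues X)"
  proof (rule inj_onI, rule ccontr)
    fix l m assume *: "l \<in> eigenvalues X" "m \<in> eigenvalues X" "ev l = ev m" "l \<noteq> m"
    have "ev l \<bullet> ev l = 0" using orth[OF *(1,2,4)] *(3) by simp
    thus False using ev[OF *(1)] by simp
  qed
  moreover have "finite (ev ` eigenvalues X)"
    using orth by (intro pairwise_orthogonal_imp_finite) (force simp: pairwise_def orthogonal_def)
  ultimately show ?thesis by (rule finite_imageD[rotated])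
qed

text \<open>
  A zero of a nonnegative quadratic form is a minimum, so the gradient vanishes there.
\<close>

lemma semidefinite_form_zero_imp_kernel:
  fixes Q :: "real^'n::finite^'n"
  assumes sym: "transpose Q = Q" and psd: "\<And>u. 0 \<le> u \<bullet> (Q *v u)" and zero: "v \<bullet> (Q *v v) = 0"
  shows "Q *v v = 0"
proof -
  define g where "g = Q *v v"
  define b where "b = g \<bullet> (Q *v g)"
  have vg: "v \<bullet> (Q *v g) = g \<bullet> g"
    using symmetric_inner_commute[OF sym, of v g] by (simp add: g_def)
  have expand: "(v + t *\<^sub>R g) \<bullet> (Q *v (v + t *\<^sub>R g)) = 2 * t * (g \<bullet> g) + t\<^sup>2 * b" for t
    using zero vg
    by (simp add: matrix_vector_right_distrib matrix_vector_mult_scaleR inner_add_left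
        inner_add_right b_def power2_eq_square algebra_simps flip: g_def)
  have b: "0 \<le> b" unfolding b_def by (rule psd)
  have lin: "0 \<le> 2 * t * (g \<bullet> g) + t\<^sup>2 * b" for t
    using psd[of "v + t *\<^sub>R g"] expand[of t] by simp
  have "g \<bullet> g = 0"
  proof (rule ccontr)
    assume "g \<bullet> g \<noteq> 0"
    hence pos: "0 < g \<bullet> g" by simp
    \<comment> \<open>A step of this length is short enough for the linear term to dominate.\<close>
    define t where "t = - (g \<bullet> g) / (1 + b)"
    have "t\<^sup>2 * b \<le> t\<^sup>2 * (1 + b)" by (intro mult_left_mono) auto
    also have "\<dots> = t * (t * (1 + b))" by (simp add: power2_eq_square)
    also have "t * (1 + b) = - (g \<bullet> g)" using b by (simp add: t_def)
    finally have "0 \<le> t * (g \<bullet> g)" using lin[of t] by simp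
    moreover have "t < 0" using pos b by (simp add: t_def field_simps)
    ultimately show False using pos by (simp add: zero_le_mult_iff)
  qed
  thus ?thesis by (simp add: g_def)
qed

text \<open>
  The Rayleigh quotient attains its maximum \<open>m\<close> on the unit sphere, and \<open>m I - X\<close> is then positive
  semidefinite with a zero at the maximizer, which is therefore an eigenvector.
\<close>

lemma rayleigh_maximum_eigenvalue:
  fixes X :: "real^'n::finite^'n"
  assumes sym: "transpose X = X"
  obtains m where "m \<in> eigenvalues X" "\<And>v. v \<bullet> (X *v v) \<le> m * (norm v)\<^sup>2"
proof -
  have "continuous_on (sphere 0 1) (\<lambda>v. v \<bullet> (X *v v))"
    by (intro continuous_intros linear_continuous_on matrix_vector_mul_bounded_linear)
  moreover have "axis undefined 1 \<in> sphere (0::real^'n) 1" by (simp add: norm_axis_1)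
  hence "sphere (0::real^'n) 1 \<noteq> {}" by blast
  ultimately obtain v0 :: "real^'n" where v0: "norm v0 = 1"
    and max: "\<And>v. norm v = 1 \<Longrightarrow> v \<bullet> (X *v v) \<le> v0 \<bullet> (X *v v0)"
    using continuous_attains_sup[OF compact_sphere, of "0::real^'n" 1 "\<lambda>v. v \<bullet> (X *v v)"]
    by auto
  define m where "m = v0 \<bullet> (X *v v0)"
  have bound: "v \<bullet> (X *v v) \<le> m * (norm v)\<^sup>2" for v
  proof (cases "v = 0")
    case False
    define u where "u = v /\<^sub>R norm v"
    have "norm u = 1" using False by (simp add: u_def)
    moreover have v: "v = norm v *\<^sub>R u" using False by (simp add: u_def)
    have "v \<bullet> (X *v v) = (norm v)\<^sup>2 * (u \<bullet> (X *v u))"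
      by (subst (1 2) v) (simp add: matrix_vector_mult_scaleR power2_eq_square)
    ultimately show ?thesis
      using max[of u] by (simp add: m_def mult.commute[of _ "(norm v)\<^sup>2"] mult_left_mono)
  qed simp
  define Q where "Q = m *\<^sub>R mat 1 - X"
  have Q: "Q *v u = m *\<^sub>R u - X *v u" for u
    by (simp add: Q_def matrix_vector_mult_diff_rdistrib scaleR_matrix_vector_assoc[symmetric])
  have "transpose Q = Q"
    using sym by (simp add: Q_def transpose_def vec_eq_iff mat_def)
  hence "Q *v v0 = 0"
    by (rule semidefinite_form_zero_imp_kernel)
       (use bound v0 in \<open>auto simp: Q inner_diff_right m_def dot_square_norm\<close>)
  hence "m \<in> eigenvalues X" using v0 unfolding eigenvalues_def by (auto simp: Q intro!: exI[of _ v0])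
  with bound show thesis by (rule that[rotated])
qed

lemma uminus_matrix_vector_mult: "(- X) *v v = - (X *v v)"
  for X :: "real^'n::finite^'m::finite"
  by (simp add: vec_eq_iff matrix_vector_mult_def sum_negf)

lemma eigenvalues_uminus_iff: "l \<in> eigenvalues (- X) \<longleftrightarrow> - l \<in> eigenvalues X"
  for X :: "real^'n::finite^'n"
proof -
  have *: "(- X) *v v = l *\<^sub>R v \<longleftrightarrow> X *v v = (- l) *\<^sub>R v" for v and l :: real
    by (metis uminus_matrix_vector_mult minus_equation_iff scaleR_minus_left)
  show ?thesis unfolding eigenvalues_def * by simp
qed

lemma quadratic_form_le_lambda_max:
  fixes X :: "real^'n::finite^'n"
  assumes sym: "transpose X = X"
  shows "v \<bullet> (X *v v) \<le> lambda_max X * (norm v)\<^sup>2"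
proof -
  obtain m where m: "m \<in> eigenvalues X" "\<And>v. v \<bullet> (X *v v) \<le> m * (norm v)\<^sup>2"
    using rayleigh_maximum_eigenvalue[OF sym] by blast
  have "m \<le> lambda_max X"
    unfolding lambda_max_def by (rule Max_ge[OF finite_eigenvalues_symmetric[OF sym] m(1)])
  thus ?thesis using m(2)[of v] by (meson mult_right_mono order_trans zero_le_power2)
qed

lemma lambda_min_le_quadratic_form:
  fixes X :: "real^'n::finite^'n"
  assumes sym: "transpose X = X"
  shows "lambda_min X * (norm v)\<^sup>2 \<le> v \<bullet> (X *v v)"
proof -
  have "transpose (- X) = - X" using sym by (simp add: transpose_def vec_eq_iff)
  then obtain m where m: "m \<in> eigenvalues (- X)" "\<And>v. v \<bullet> ((- X) *v v) \<le> m * (norm v)\<^sup>2"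
    using rayleigh_maximum_eigenvalue by blast
  have "- m \<in> eigenvalues X" using m(1) by (simp add: eigenvalues_uminus_iff)
  hence "lambda_min X \<le> - m"
    unfolding lambda_min_def by (rule Min_le[OF finite_eigenvalues_symmetric[OF sym]])
  hence "lambda_min X * (norm v)\<^sup>2 \<le> - m * (norm v)\<^sup>2" by (intro mult_right_mono) auto
  thus ?thesis using m(2)[of v] by (simp add: uminus_matrix_vector_mult)
qed

lemma lambda_min_pos:
  fixes X :: "real^'n::finite^'n"
  assumes "sym_pos_def X"
  shows "0 < lambda_min X"
proof -
  have sym: "transpose X = X" and pos: "\<And>v. v \<noteq> 0 \<Longrightarrow> v \<bullet> (X *v v) > 0"
    using assms by (auto simp: sym_pos_def_def)
  have "eigenvalues X \<noteq> {}" using rayleigh_maximum_eigenvalue[OF sym] by blast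
  hence "lambda_min X \<in> eigenvalues X"
    unfolding lambda_min_def by (rule Min_in[OF finite_eigenvalues_symmetric[OF sym]])
  then obtain v where "v \<noteq> 0" "X *v v = lambda_min X *\<^sub>R v" unfolding eigenvalues_def by blast
  thus ?thesis using pos[of v] inner_ge_zero[of v] by (auto simp: zero_less_mult_iff)
qed

lemma lambda_max_pos:
  fixes X :: "real^'n::finite^'n"
  assumes "sym_pos_def X"
  shows "0 < lambda_max X"
proof -
  have sym: "transpose X = X" and pos: "\<And>v. v \<noteq> 0 \<Longrightarrow> v \<bullet> (X *v v) > 0"
    using assms by (auto simp: sym_pos_def_def)
  define v :: "real^'n" where "v = axis undefined 1"
  have "v \<noteq> 0" "norm v = 1" by (simp_all add: v_def axis_eq_0_iff norm_axis_1)
  thus ?thesis using pos[of v] quadratic_form_le_lambda_max[OF sym, of v] by simp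
qed

section \<open>Block vectors\<close>

definition stack :: "real^'m::finite \<Rightarrow> real^'n::finite \<Rightarrow> real^('m + 'n)" where
  "stack x y = (\<chi> i. case i of Inl a \<Rightarrow> x $ a | Inr b \<Rightarrow> y $ b)"

lemma stack_nth [simp]: "stack x y $ Inl a = x $ a" "stack x y $ Inr b = y $ b"
  by (simp_all add: stack_def)

lemma stack_eq_iff [simp]: "stack x y = stack x' y' \<longleftrightarrow> x = x' \<and> y = y'"
  by (metis stack_nth vec_eq_iff)

lemma stack_zero: "stack 0 0 = 0"
  by (simp add: vec_eq_iff stack_def split: sum.split)

lemma stack_add: "stack x y + stack x' y' = stack (x + x') (y + y')"
  by (simp add: vec_eq_iff stack_def split: sum.split)

lemma sum_UNIV_sum:
  "(\<Sum>i\<in>UNIV. f i) = (\<Sum>a\<in>UNIV. f (Inl a)) + (\<Sum>b\<in>UNIV. f (Inr b))"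
  for f :: "'a::finite + 'b::finite \<Rightarrow> real"
  using sum.Plus[of "UNIV :: 'a set" "UNIV :: 'b set" f] by (simp add: comp_def)

lemma sum_UNIV_prod: "(\<Sum>c\<in>UNIV. f c) = (\<Sum>i\<in>UNIV. \<Sum>j\<in>UNIV. f (i, j))"
  for f :: "'a::finite \<times> 'b::finite \<Rightarrow> real"
  unfolding UNIV_Times_UNIV[symmetric] by (simp add: sum.cartesian_product)

lemma inner_stack: "stack x y \<bullet> stack x' y' = x \<bullet> x' + y \<bullet> y'"
  by (simp add: inner_vec_def sum_UNIV_sum)

lemma norm_stack: "norm (stack x y) = norm (x, y)"
  by (simp add: norm_eq_sqrt_inner inner_stack inner_Pair)

lemma bounded_linear_stack: "bounded_linear (\<lambda>p. stack (fst p) (snd p))"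
  by (rule linear_conv_bounded_linear[THEN iffD1], rule linearI)
     (simp_all add: vec_eq_iff stack_def split: sum.split)

lemma vcat_mult: "vcat X Y *v z = stack (X *v z) (Y *v z)"
  by (simp add: vec_eq_iff vcat_def stack_def matrix_vector_mult_def split: sum.split)

lemma hcat_mult_stack: "hcat X Y *v stack x y = X *v x + Y *v y"
  by (simp add: vec_eq_iff hcat_def matrix_vector_mult_def sum_UNIV_sum)

lemma block2_mult_stack:
  "block2 X Y Z W *v stack x y = stack (X *v x + Y *v y) (Z *v x + W *v y)"
  by (simp add: block2_def vcat_mult hcat_mult_stack)

lemma J_mat_stack: "J_mat *v stack x w = x"
  by (simp add: J_mat_def hcat_mult_stack)

lemma Ju_mat_stack: "Ju_mat *v stack u v = u"
  by (simp add: Ju_mat_def hcat_mult_stack)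

lemma transpose_columns_mult:
  "transpose (\<chi> r c. f c $ r) *v z = (\<chi> c. f c \<bullet> z)"
  for f :: "'c::finite \<Rightarrow> real^'n::finite"
  by (simp add: vec_eq_iff matrix_vector_mult_def transpose_def inner_vec_def)

section \<open>The quadratic form of the linear matrix inequality\<close>

lemma diag_mat_mult: "diag_mat f *v v = (\<chi> i. f i * v $ i)"
proof -
  have "(\<Sum>j\<in>UNIV. (if i = j then f i else 0) * v $ j) = f i * v $ i" for i
    by (simp add: if_distrib[of "\<lambda>a. a * _"] sum.delta cong: if_cong)
  thus ?thesis by (simp add: vec_eq_iff diag_mat_def matrix_vector_mult_def)
qed

lemma kappa_sum_form:
  "stack x w \<bullet> (kappa_sum \<kappa> *v stack x w) = (\<Sum>i\<in>UNIV. \<Sum>j\<in>UNIV. \<kappa> $ i $ j * (x $ j)\<^sup>2)"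
proof -
  have mult_sum: "sum f S *v z = (\<Sum>i\<in>S. f i *v z)"
    if "finite S" for f :: "'c \<Rightarrow> real^'n::finite^'m::finite" and S z
    using that by (induction S rule: finite_induct) (simp_all add: matrix_vector_mult_add_rdistrib)
  have rank_one: "(columnvector e :: real^1^'a) *v (rowvector e *v y) = (e \<bullet> y) *\<^sub>R e"
    for e y :: "real^'a"
    by (simp add: vec_eq_iff matrix_vector_mult_def columnvector_def rowvector_def inner_vec_def
        mult.commute)
  have summand: "stack x w \<bullet> ((transpose J_mat ** (columnvector (axis j 1) :: real^1^'a)
      ** rowvector (axis j 1) ** J_mat) *v stack x w) = (x $ j)\<^sup>2" for j
    by (simp add: matrix_vector_mul_assoc[symmetric] J_mat_stack rank_one inner_matrix_transpose
        inner_axis' inner_axis power2_eq_square del: transpose_matrix_vector)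
  show ?thesis
    by (simp add: kappa_sum_def mult_sum inner_sum_right scaleR_matrix_vector_assoc[symmetric] summand)
qed

lemma H1_mat_mult:
  assumes "transpose P = P"
  shows "transpose (H1_mat P) *v z = (\<chi> c. (J_mat *v (P *v z)) $ fst c)"
    and "transpose (H1_tilde P) *v z = (\<chi> c. (J_mat *v (P *v z)) $ fst c)"
proof -
  have "(P *v (transpose J_mat *v axis i 1)) \<bullet> z = (J_mat *v (P *v z)) $ i" for i
    using symmetric_inner_commute[OF assms, of "transpose J_mat *v axis i 1" z]
      inner_matrix_transpose[of "axis i 1" J_mat "P *v z"]
    by (simp add: inner_axis' del: transpose_matrix_vector)
  thus "transpose (H1_mat P) *v z = (\<chi> c. (J_mat *v (P *v z)) $ fst c)"
    and "transpose (H1_tilde P) *v z = (\<chi> c. (J_mat *v (P *v z)) $ fst c)"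
    unfolding H1_mat_def H1_tilde_def transpose_columns_mult by simp_all
qed

lemma F_C_bar_stack:
  "F_mat Bc Cc Dc *v (C_bar C *v stack x w) = stack (Cc *v w + Dc *v (C *v x)) (Bc *v (C *v x))"
  by (simp add: F_mat_def C_bar_def block2_mult_stack add.commute)

lemma H2_mat_mult:
  "transpose (H2_mat C Bc Cc Dc :: real^('nx::finite \<times> 'nu::finite)^('nx + 'nu)) *v stack x w =
    (\<chi> c. (Cc *v w + Dc *v (C *v x)) $ snd c)"
proof -
  have "(transpose (C_bar C) *v (transpose (F_mat Bc Cc Dc) *v (transpose Ju_mat *v axis k 1)))
      \<bullet> stack x w = (Cc *v w + Dc *v (C *v x)) $ k" for k
    by (simp add: inner_matrix_transpose[symmetric] F_C_bar_stack Ju_mat_stack inner_axis'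
        del: transpose_matrix_vector)
  thus ?thesis unfolding H2_mat_def transpose_columns_mult by simp
qed

lemma M_mat_form:
  fixes x :: "real^'nx::finite" and w :: "real^'nu::finite"
  shows "stack x w \<bullet> (M_mat A B C \<alpha> P Bc Cc Dc *v stack x w) =
    2 * (stack x w \<bullet> (P *v stack (A *v x + B *v (Cc *v w + Dc *v (C *v x))) (Bc *v (C *v x))))
    + \<alpha> * (norm (stack x w))\<^sup>2"
proof -
  define X where "X = P ** A_bar A + P ** B_bar B ** F_mat Bc Cc Dc ** C_bar C"
  have "X *v stack x w = P *v stack (A *v x + B *v (Cc *v w + Dc *v (C *v x))) (Bc *v (C *v x))"
    by (simp add: X_def matrix_vector_mult_add_rdistrib matrix_vector_mul_assoc[symmetric]
        F_C_bar_stack)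
       (simp add: A_bar_def B_bar_def block2_mult_stack stack_add
        matrix_vector_right_distrib[symmetric])
  moreover have "stack x w \<bullet> (herm X *v stack x w) = 2 * (stack x w \<bullet> (X *v stack x w))"
    using inner_matrix_transpose[of "stack x w" "transpose X" "stack x w"]
      inner_commute[of "X *v stack x w" "stack x w"]
    by (simp add: herm_def matrix_vector_mult_add_rdistrib inner_add_right
        del: transpose_matrix_vector)
  ultimately show ?thesis
    by (simp add: M_mat_def X_def[symmetric] matrix_vector_mult_add_rdistrib inner_add_right
        scaleR_matrix_vector_assoc[symmetric] power2_norm_eq_inner)
qed

text \<open>
  The blocks \<open>p\<close>, \<open>q\<close>, \<open>r\<close>, \<open>d\<close> stay free here. Each of them enters once linearly, through the first
  block column, and once as a negative square, through the diagonal. The vector \<open>g\<close> is the part of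
  \<open>P z\<close>, \<open>z = (x, w)\<close>, that disturbances of the plant equation act on.
\<close>

lemma lmi_matrix_form:
  fixes x :: "real^'nx::finite" and w :: "real^'nu::finite" and P :: "real^('nx + 'nu)^('nx + 'nu)"
    and C :: "real^'nx^'ny::finite" and Cc :: "real^'nu^'nu" and Bc Dc :: "real^'ny^'nu"
    and p :: "real^('nx \<times> 'nx)" and q r :: "real^('nx \<times> 'nu)" and d :: "real^'nx"
  assumes sym: "transpose P = P"
  defines "u \<equiv> Cc *v w + Dc *v (C *v x)"
  defines "g \<equiv> J_mat *v (P *v stack x w)"
  defines "v \<equiv> stack (stack x w) (stack p (stack q (stack r d)))"
  shows "v \<bullet> (lmi_matrix A B C Ab Bb \<alpha> \<zeta> \<kappa> \<mu> P Bc Cc Dc *v v) =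
    2 * (stack x w \<bullet> (P *v stack (A *v x + B *v u) (Bc *v (C *v x)))) + \<alpha> * (norm (stack x w))\<^sup>2
    + (\<Sum>i\<in>UNIV. \<Sum>j\<in>UNIV. \<kappa> $ i $ j * (x $ j)\<^sup>2 + 2 * (p $ (i, j) * g $ i)
        - \<kappa> $ i $ j * inverse (Ab $ i $ j ^ 2) * (p $ (i, j))\<^sup>2)
    + (\<Sum>i\<in>UNIV. \<Sum>k\<in>UNIV. 2 * (q $ (i, k) * g $ i)
        - \<mu> $ i $ k * inverse (Bb $ i $ k ^ 2) * (q $ (i, k))\<^sup>2
        + 2 * (r $ (i, k) * u $ k) - inverse (\<mu> $ i $ k) * (r $ (i, k))\<^sup>2)
    + 2 * (d \<bullet> g) - \<zeta> * (norm d)\<^sup>2"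
proof -
  define z where "z = stack x w"
  define y where "y = stack p (stack q (stack r d))"
  define V where "V = vcat (transpose (H1_mat P)) (vcat (transpose (H1_tilde P))
    (vcat (transpose (H2_mat C Bc Cc Dc)) (J_mat ** P)))"
  define D where "D = block2 (G1_mat Ab \<kappa>) 0 0 (block2 (G2_mat Bb \<mu>) 0
      0 (block2 (G3_mat \<mu>) 0 0 (- \<zeta> *\<^sub>R (mat 1 :: real^'nx^'nx))))"
  have Vz: "y \<bullet> (V *v z) = (\<Sum>i\<in>UNIV. \<Sum>j\<in>UNIV. p $ (i, j) * g $ i)
      + (\<Sum>i\<in>UNIV. \<Sum>k\<in>UNIV. q $ (i, k) * g $ i) + (\<Sum>i\<in>UNIV. \<Sum>k\<in>UNIV. r $ (i, k) * u $ k) + d \<bullet> g"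
    unfolding V_def y_def z_def vcat_mult H1_mat_mult[OF sym] H2_mat_mult
      matrix_vector_mul_assoc[symmetric] g_def[symmetric] u_def[symmetric] inner_stack
    by (simp add: inner_vec_def[of p] inner_vec_def[of q] inner_vec_def[of r] sum_UNIV_prod)
  have Dy: "y \<bullet> (D *v y) =
      - (\<Sum>i\<in>UNIV. \<Sum>j\<in>UNIV. \<kappa> $ i $ j * inverse (Ab $ i $ j ^ 2) * (p $ (i, j))\<^sup>2)
      - (\<Sum>i\<in>UNIV. \<Sum>k\<in>UNIV. \<mu> $ i $ k * inverse (Bb $ i $ k ^ 2) * (q $ (i, k))\<^sup>2)
      - (\<Sum>i\<in>UNIV. \<Sum>k\<in>UNIV. inverse (\<mu> $ i $ k) * (r $ (i, k))\<^sup>2) - \<zeta> * (norm d)\<^sup>2"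
    by (simp add: D_def y_def block2_mult_stack inner_stack G1_mat_def G2_mat_def G3_mat_def
        diag_mat_mult inner_vec_def[of p] inner_vec_def[of q] inner_vec_def[of r] sum_UNIV_prod
        scaleR_matrix_vector_assoc[symmetric] dot_square_norm sum_negf power2_eq_square
        uminus_matrix_vector_mult mult_ac)
  have "v \<bullet> (lmi_matrix A B C Ab Bb \<alpha> \<zeta> \<kappa> \<mu> P Bc Cc Dc *v v) =
      z \<bullet> ((M_mat A B C \<alpha> P Bc Cc Dc + kappa_sum \<kappa>) *v z) + z \<bullet> (transpose V *v y)
      + (y \<bullet> (V *v z) + y \<bullet> (D *v y))"
    unfolding lmi_matrix_def Let_def V_def[symmetric] D_def[symmetric] v_def y_def[symmetric]
      z_def[symmetric] block2_mult_stack inner_stack inner_add_right by simp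
  also have "z \<bullet> (transpose V *v y) = y \<bullet> (V *v z)"
    by (metis inner_commute inner_matrix_transpose)
  finally show ?thesis
    unfolding Vz Dy matrix_vector_mult_add_rdistrib inner_add_right
      M_mat_form[of x w, folded z_def] u_def[symmetric] kappa_sum_form[of x w, folded z_def] z_def[symmetric]
    by (simp add: sum.distrib sum_subtractf sum_distrib_left algebra_simps)
qed

section \<open>Dissipation and the steady state\<close>

text \<open>
  The auxiliary vectors are chosen so that the cross terms of the quadratic form add up to the
  effect of the uncertainty on \<open>V\<close>, while the box constraints make the remaining square terms
  nonnegative entry by entry.
\<close>

lemma lmi_dissipation:
  fixes x :: "real^'nx::finite" and w :: "real^'nu::finite" and P :: "real^('nx + 'nu)^('nx + 'nu)"
    and C :: "real^'nx^'ny::finite"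
  assumes feas: "feasible A B C Ab Bb \<alpha> \<zeta> \<kappa> \<mu> P Bc Cc Dc"
    and pos: "\<forall>i j. Ab $ i $ j > 0" "\<forall>i k. Bb $ i $ k > 0"
    and box: "\<forall>i j. \<bar>As $ i $ j - A $ i $ j\<bar> \<le> Ab $ i $ j"
             "\<forall>i k. \<bar>Bs $ i $ k - B $ i $ k\<bar> \<le> Bb $ i $ k"
  shows "2 * (stack x w \<bullet> (P *v stack (As *v x + Bs *v (Cc *v w + Dc *v (C *v x)) + d) (Bc *v (C *v x))))
     \<le> - \<alpha> * (norm (stack x w))\<^sup>2 + \<zeta> * (norm d)\<^sup>2"
proof -
  define u where "u = Cc *v w + Dc *v (C *v x)"
  define g where "g = J_mat *v (P *v stack x w)"
  define a where "a i j = As $ i $ j - A $ i $ j" for i j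
  define b where "b i k = Bs $ i $ k - B $ i $ k" for i k
  define p :: "real^('nx \<times> 'nx)" where "p = (\<chi> c. a (fst c) (snd c) * x $ snd c)"
  define q :: "real^('nx \<times> 'nu)" where "q = (\<chi> c. b (fst c) (snd c) * u $ snd c)"
  \<comment> \<open>The weight \<open>\<mu>\<close> maximizes \<open>2 r u - r\<^sup>2 / \<mu>\<close>, with value \<open>\<mu> u\<^sup>2\<close>.\<close>
  define r :: "real^('nx \<times> 'nu)" where "r = (\<chi> c. \<mu> $ fst c $ snd c * u $ snd c)"
  have sym: "transpose P = P" and \<kappa>: "\<And>i j. \<kappa> $ i $ j > 0" and \<mu>: "\<And>i k. \<mu> $ i $ k > 0"
    and nsd: "\<And>v. v \<bullet> (lmi_matrix A B C Ab Bb \<alpha> \<zeta> \<kappa> \<mu> P Bc Cc Dc *v v) \<le> 0"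
    using feas by (auto simp: feasible_def sym_pos_def_def neg_semidef_def)
  have weighted: "m * inverse (c\<^sup>2) * (e * s)\<^sup>2 \<le> m * s\<^sup>2"
    if "0 < m" "0 < c" "\<bar>e\<bar> \<le> c" for m c e s :: real
  proof -
    have "e\<^sup>2 \<le> c\<^sup>2" using that by (metis abs_le_square_iff abs_of_pos)
    hence "inverse (c\<^sup>2) * e\<^sup>2 \<le> 1" using that by (simp add: field_simps)
    hence "(m * s\<^sup>2) * (inverse (c\<^sup>2) * e\<^sup>2) \<le> (m * s\<^sup>2) * 1"
      using that by (intro mult_left_mono) auto
    thus ?thesis by (simp add: power_mult_distrib mult_ac)
  qed
  have A_part: "2 * (a i j * x $ j * g $ i) \<le> \<kappa> $ i $ j * (x $ j)\<^sup>2 + 2 * (p $ (i, j) * g $ i)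
      - \<kappa> $ i $ j * inverse (Ab $ i $ j ^ 2) * (p $ (i, j))\<^sup>2" for i j
    using weighted[of "\<kappa> $ i $ j" "Ab $ i $ j" "a i j" "x $ j"] \<kappa> pos box
    by (simp add: p_def a_def)
  have B_part: "2 * (b i k * u $ k * g $ i) \<le> 2 * (q $ (i, k) * g $ i)
        - \<mu> $ i $ k * inverse (Bb $ i $ k ^ 2) * (q $ (i, k))\<^sup>2
        + 2 * (r $ (i, k) * u $ k) - inverse (\<mu> $ i $ k) * (r $ (i, k))\<^sup>2" for i k
  proof -
    have "inverse (\<mu> $ i $ k) * (\<mu> $ i $ k * u $ k)\<^sup>2 = \<mu> $ i $ k * (u $ k)\<^sup>2"
      using \<mu>[of i k] by (simp add: field_simps power2_eq_square)
    moreover have "\<mu> $ i $ k * inverse (Bb $ i $ k ^ 2) * (b i k * u $ k)\<^sup>2 \<le> \<mu> $ i $ k * (u $ k)\<^sup>2"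
      using \<mu> pos box by (intro weighted) (auto simp: b_def)
    moreover have "\<mu> $ i $ k * u $ k * u $ k = \<mu> $ i $ k * (u $ k)\<^sup>2"
      by (simp add: power2_eq_square)
    moreover have qr: "q $ (i, k) = b i k * u $ k" "r $ (i, k) = \<mu> $ i $ k * u $ k"
      by (simp_all add: q_def r_def)
    ultimately show ?thesis unfolding qr by linarith
  qed
  have "(\<Sum>i\<in>UNIV. \<Sum>j\<in>UNIV. 2 * (a i j * x $ j * g $ i)) = 2 * (g \<bullet> ((As - A) *v x))"
    by (simp add: a_def inner_vec_def matrix_vector_mult_def sum_distrib_left mult_ac)
  moreover have "(\<Sum>i\<in>UNIV. \<Sum>k\<in>UNIV. 2 * (b i k * u $ k * g $ i)) = 2 * (g \<bullet> ((Bs - B) *v u))"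
    by (simp add: b_def inner_vec_def matrix_vector_mult_def sum_distrib_left mult_ac)
  moreover have "2 * (stack x w \<bullet> (P *v stack (A *v x + B *v u) (Bc *v (C *v x))))
      + \<alpha> * (norm (stack x w))\<^sup>2
      + (\<Sum>i\<in>UNIV. \<Sum>j\<in>UNIV. 2 * (a i j * x $ j * g $ i))
      + (\<Sum>i\<in>UNIV. \<Sum>k\<in>UNIV. 2 * (b i k * u $ k * g $ i)) + 2 * (d \<bullet> g) - \<zeta> * (norm d)\<^sup>2
      \<le> stack (stack x w) (stack p (stack q (stack r d))) \<bullet>
        (lmi_matrix A B C Ab Bb \<alpha> \<zeta> \<kappa> \<mu> P Bc Cc Dc *v
         stack (stack x w) (stack p (stack q (stack r d))))"
    unfolding lmi_matrix_form[OF sym] u_def[symmetric] g_def[symmetric]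
    by (intro add_mono diff_mono sum_mono A_part B_part order_refl)
  ultimately have le: "2 * (stack x w \<bullet> (P *v stack (A *v x + B *v u) (Bc *v (C *v x))))
      + 2 * (g \<bullet> ((As - A) *v x + (Bs - B) *v u + d)) + \<alpha> * (norm (stack x w))\<^sup>2 \<le> \<zeta> * (norm d)\<^sup>2"
    using nsd[of "stack (stack x w) (stack p (stack q (stack r d)))"]
    by (simp add: inner_add_right inner_commute)
  have g: "stack x w \<bullet> (P *v stack h 0) = g \<bullet> h" for h :: "real^'nx"
  proof -
    have "P *v stack x w = stack g (\<chi> k. (P *v stack x w) $ Inr k)"
      by (simp add: g_def vec_eq_iff stack_def J_mat_def hcat_def matrix_vector_mult_def[of "\<chi> i j. _ i j"]
          sum_UNIV_sum mat_def if_distrib[of "\<lambda>a. a * _"] sum.delta cong: if_cong split: sum.split)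
    thus ?thesis using symmetric_inner_commute[OF sym, of "stack x w" "stack h 0"]
      by (metis add.right_neutral inner_stack inner_zero_right)
  qed
  have "stack (As *v x + Bs *v u + d) (Bc *v (C *v x)) =
      stack (A *v x + B *v u) (Bc *v (C *v x)) + stack ((As - A) *v x + (Bs - B) *v u + d) 0"
    by (simp add: stack_add matrix_vector_mult_diff_rdistrib)
  hence "stack x w \<bullet> (P *v stack (As *v x + Bs *v u + d) (Bc *v (C *v x))) =
      stack x w \<bullet> (P *v stack (A *v x + B *v u) (Bc *v (C *v x)))
      + g \<bullet> ((As - A) *v x + (Bs - B) *v u + d)"
    by (simp only: matrix_vector_right_distrib inner_add_right g)
  with le show ?thesis unfolding u_def by simp
qed

text \<open>
  If \<open>Cc v = 0\<close>, then \<open>(0, v)\<close> is an equilibrium of the linear closed loop, and dissipation leaves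
  room for the zero equilibrium only. So every steady input is produced by some controller state.
\<close>

lemma controller_output_surj:
  fixes P :: "real^('nx::finite + 'nu::finite)^('nx + 'nu)" and C :: "real^'nx^'ny::finite"
  assumes feas: "feasible A B C Ab Bb \<alpha> \<zeta> \<kappa> \<mu> P Bc Cc Dc"
    and pos: "\<forall>i j. Ab $ i $ j > 0" "\<forall>i k. Bb $ i $ k > 0" and "\<alpha> > 0"
  shows "surj (\<lambda>w. Cc *v w)"
proof -
  have "v = 0" if "Cc *v v = 0" for v
  proof -
    have "\<alpha> * (norm (stack (0::real^'nx) v))\<^sup>2 \<le> 0"
      using lmi_dissipation[OF feas pos, of A B 0 v 0] pos that
      by (simp add: stack_zero less_imp_le)
    hence "norm (stack (0::real^'nx) v) = 0"
      using \<open>\<alpha> > 0\<close> by (simp add: mult_le_0_iff)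
    thus "v = 0" by (metis norm_eq_zero stack_eq_iff stack_zero)
  qed
  hence "inj (\<lambda>w. Cc *v w)"
    by (subst linear_injective_0) auto
  thus ?thesis by (rule linear_injective_imp_surjective[OF matrix_vector_mul_linear]) simp
qed

section \<open>Lyapunov estimate along solutions\<close>

text \<open>
  The integrating factor \<open>exp (r t)\<close> makes \<open>exp (r t) (V t - b / r)\<close> nonincreasing.
\<close>

lemma linear_differential_inequality:
  fixes V V' :: "real \<Rightarrow> real"
  assumes deriv: "\<And>t. t \<ge> 0 \<Longrightarrow> (V has_real_derivative V' t) (at t within {0..})"
    and ineq: "\<And>t. t \<ge> 0 \<Longrightarrow> V' t \<le> - r * V t + b"
    and "r > 0" "t \<ge> 0"
  shows "V t \<le> b / r + exp (- r * t) * (V 0 - b / r)"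
proof -
  define g where "g s = exp (r * s) * (V s - b / r)" for s
  have g': "(g has_real_derivative exp (r * s) * (r * (V s - b / r) + V' s)) (at s within {0..})"
    if "s \<ge> 0" for s
    unfolding g_def by (auto intro!: derivative_eq_intros deriv that simp: algebra_simps)
  have "g t \<le> g 0"
  proof (cases "t = 0")
    case False
    hence "0 < t" using \<open>t \<ge> 0\<close> by simp
    have "\<exists>s\<in>{0<..<t}. g t - g 0 = exp (r * s) * (r * (V s - b / r) + V' s) * (t - 0)"
    proof (rule mvt_simple[OF \<open>0 < t\<close>])
      fix s assume "0 \<le> s" "s \<le> t"
      thus "(g has_derivative (*) (exp (r * s) * (r * (V s - b / r) + V' s))) (at s within {0..t})"
        using has_field_derivative_subset[OF g'[of s], of "{0..t}"]
        by (auto simp: has_field_derivative_def)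
    qed
    then obtain s where s: "0 < s" "s < t"
      and eq: "g t - g 0 = exp (r * s) * (r * (V s - b / r) + V' s) * t" by auto
    have "r * (V s - b / r) + V' s \<le> 0"
      using ineq[of s] s \<open>r > 0\<close> by (simp add: algebra_simps)
    hence "g t - g 0 \<le> 0"
      unfolding eq using \<open>0 < t\<close> by (simp add: mult_le_0_iff)
    thus ?thesis by simp
  qed simp
  hence "exp (- r * t) * g t \<le> exp (- r * t) * g 0" by (intro mult_left_mono) auto
  moreover have "exp (- r * t) * g t = V t - b / r"
    by (simp add: g_def mult.assoc[symmetric] exp_add[symmetric])
  moreover have g0: "g 0 = V 0 - b / r" by (simp add: g_def)
  ultimately show ?thesis unfolding g0 by linarith
qed

lemma quadratic_form_has_derivative:
  fixes P :: "real^'n::finite^'n"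
  assumes sym: "transpose P = P" and "(z has_vector_derivative z') (at t within S)"
  shows "((\<lambda>t. z t \<bullet> (P *v z t)) has_real_derivative 2 * (z t \<bullet> (P *v z'))) (at t within S)"
proof -
  have "((\<lambda>t. P *v z t) has_vector_derivative P *v z') (at t within S)"
    by (rule bounded_linear.has_vector_derivative[OF matrix_vector_mul_bounded_linear assms(2)])
  from bounded_bilinear.has_vector_derivative[OF bounded_bilinear_inner assms(2) this]
  show ?thesis
    using symmetric_inner_commute[OF sym, of "z t" z']
    by (simp add: has_real_derivative_iff_has_vector_derivative inner_commute)
qed

text \<open>
  Subtracting the equilibrium equation eliminates \<open>yd\<close> and \<open>ud\<close> and leaves the matrices of the
  dissipation inequality.
\<close>

lemma closed_loop_error_dynamics:
  fixes x xd :: "real^'nx::finite" and w wd :: "real^'nu::finite" and C :: "real^'nx^'ny::finite"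
  assumes "yd = C *v xd" "As *v xd + ks xd = - (Bs *v ud)" "Cc *v wd = ud"
  shows "closed_loop_rhs As Bs ks C yd Bc Cc Dc (x, w) =
    (As *v (x - xd) + Bs *v (Cc *v (w - wd) + Dc *v (C *v (x - xd))) + (ks x - ks xd),
     Bc *v (C *v (x - xd)))"
proof -
  have "Bs *v (Cc *v w + Dc *v (C *v x - C *v xd)) =
      Bs *v (Cc *v (w - wd) + Dc *v (C *v (x - xd))) + Bs *v ud"
    using assms(3)
    by (simp add: matrix_vector_right_distrib matrix_vector_mult_diff_distrib)
  moreover have "Bs *v ud = - (As *v xd) - ks xd"
    using assms(2) by (metis add.inverse_inverse diff_conv_add_uminus minus_add_distrib)
  ultimately show ?thesis
    using assms(1)
    by (simp add: closed_loop_rhs_def plant_rhs_def control_input_def matrix_vector_mult_diff_distrib)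
qed

text \<open>
  The rate \<open>r\<close> comes from weakening \<open>- \<alpha> \<parallel>e\<parallel>\<^sup>2\<close> to \<open>- r V\<close>, and the offset is \<open>\<zeta> kb\<^sup>2\<close> divided by it.
\<close>

lemma closed_loop_estimate:
  fixes P :: "real^('nx::finite + 'nu::finite)^('nx + 'nu)" and C :: "real^'nx^'ny::finite"
    and x :: "real \<Rightarrow> real^'nx" and w :: "real \<Rightarrow> real^'nu" and xd :: "real^'nx" and wd :: "real^'nu"
    and \<alpha> t :: real
  assumes feas: "feasible A B C Ab Bb \<alpha> \<zeta> \<kappa> \<mu> P Bc Cc Dc" and "\<alpha> > 0"
    and pos: "\<forall>i j. Ab $ i $ j > 0" "\<forall>i k. Bb $ i $ k > 0"
    and box: "\<forall>i j. \<bar>As $ i $ j - A $ i $ j\<bar> \<le> Ab $ i $ j"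
             "\<forall>i k. \<bar>Bs $ i $ k - B $ i $ k\<bar> \<le> Bb $ i $ k"
    and nonlin: "\<forall>x1 x2. norm (ks x1 - ks x2) \<le> kb"
    and eq: "yd = C *v xd" "As *v xd + ks xd = - (Bs *v ud)" "Cc *v wd = ud"
    and sol: "solution (closed_loop_rhs As Bs ks C yd Bc Cc Dc) (\<lambda>t. (x t, w t))" and "t \<ge> 0"
  defines "e \<equiv> \<lambda>t. stack (x t - xd) (w t - wd)"
  defines "r \<equiv> \<alpha> / lambda_max P"
  shows "lambda_min P * (norm (e t))\<^sup>2 \<le> \<zeta> * kb\<^sup>2 / r + exp (- r * t) * (e 0 \<bullet> (P *v e 0) - \<zeta> * kb\<^sup>2 / r)"
proof -
  have spd: "sym_pos_def P" and sym: "transpose P = P" and "\<zeta> > 0"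
    using feas by (auto simp: feasible_def sym_pos_def_def)
  define V where "V s = e s \<bullet> (P *v e s)" for s
  define e' where "e' s = stack (As *v (x s - xd) + Bs *v (Cc *v (w s - wd) + Dc *v (C *v (x s - xd)))
      + (ks (x s) - ks xd)) (Bc *v (C *v (x s - xd)))" for s
  have deriv: "(V has_real_derivative 2 * (e s \<bullet> (P *v e' s))) (at s within {0..})" if "s \<ge> 0" for s
  proof -
    have "((\<lambda>t. (x t, w t)) has_vector_derivative
        closed_loop_rhs As Bs ks C yd Bc Cc Dc (x s, w s)) (at s within {0..})"
      using sol that by (simp add: solution_def)
    hence "((\<lambda>t. (x t, w t) - (xd, wd)) has_vector_derivative
        closed_loop_rhs As Bs ks C yd Bc Cc Dc (x s, w s)) (at s within {0..})"
      using has_vector_derivative_diff[OF _ has_vector_derivative_const] by fastforce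
    from bounded_linear.has_vector_derivative[OF bounded_linear_stack this]
    have "(e has_vector_derivative e' s) (at s within {0..})"
      by (simp add: e_def e'_def closed_loop_error_dynamics[where ks=ks, OF eq])
    thus ?thesis unfolding V_def by (rule quadratic_form_has_derivative[OF sym])
  qed
  have ineq: "2 * (e s \<bullet> (P *v e' s)) \<le> - r * V s + \<zeta> * kb\<^sup>2" for s
  proof -
    have "2 * (e s \<bullet> (P *v e' s)) \<le> - \<alpha> * (norm (e s))\<^sup>2 + \<zeta> * (norm (ks (x s) - ks xd))\<^sup>2"
      unfolding e_def e'_def by (rule lmi_dissipation[OF feas pos box])
    moreover have "\<zeta> * (norm (ks (x s) - ks xd))\<^sup>2 \<le> \<zeta> * kb\<^sup>2"
      using \<open>\<zeta> > 0\<close> nonlin by (intro mult_left_mono power_mono) auto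
    moreover have "r * V s \<le> r * (lambda_max P * (norm (e s))\<^sup>2)"
      unfolding V_def r_def using \<open>\<alpha> > 0\<close> lambda_max_pos[OF spd]
      by (intro mult_left_mono quadratic_form_le_lambda_max[OF sym]) auto
    moreover have "r * (lambda_max P * (norm (e s))\<^sup>2) = \<alpha> * (norm (e s))\<^sup>2"
      using lambda_max_pos[OF spd] by (simp add: r_def)
    ultimately show ?thesis by linarith
  qed
  have "r > 0" using \<open>\<alpha> > 0\<close> lambda_max_pos[OF spd] by (simp add: r_def)
  have "V t \<le> \<zeta> * kb\<^sup>2 / r + exp (- r * t) * (V 0 - \<zeta> * kb\<^sup>2 / r)"
    by (rule linear_differential_inequality[OF deriv ineq \<open>r > 0\<close> \<open>t \<ge> 0\<close>])
  thus ?thesis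
    unfolding V_def using lambda_min_le_quadratic_form[OF sym, of "e t"] by linarith
qed

lemma output_le_induced_norm:
  fixes x :: "real^'nx::finite" and w :: "real^'nu::finite" and C :: "real^'nx^'ny::finite"
  shows "norm (C *v x) \<le>
    induced_norm (C_bar C :: real^('nx + 'nu)^('ny + 'nu)) * norm (stack x w)"
proof -
  have "norm (C *v x) \<le> norm (stack (C *v x) w)"
    using norm_fst_le[of "C *v x" w] by (simp add: norm_stack)
  also have "stack (C *v x) w = C_bar C *v stack x w"
    by (simp add: C_bar_def block2_mult_stack)
  also have "norm \<dots> \<le> induced_norm (C_bar C :: real^('nx + 'nu)^('ny + 'nu)) * norm (stack x w)"
    unfolding induced_norm_def by (rule onorm[OF matrix_vector_mul_bounded_linear])
  finally show ?thesis .
qed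

section \<open>Practical output regulation\<close>

theorem theorem3p3:
  fixes A As Ab :: "real^('nx::finite)^'nx"
    and B Bs Bb :: "real^('nu::finite)^'nx"
    and C :: "real^'nx^'ny"
    and ks :: "real^'nx \<Rightarrow> real^'nx"
    and yd :: "real^'ny"
    and kb \<alpha> \<zeta> :: real
    and \<kappa> :: "real^'nx^'nx"
    and \<mu> :: "real^'nu^'nx"
    and P :: "real^('nx + 'nu)^('nx + 'nu)"
    and Bc Dc :: "real^'ny^'nu"
    and Cc :: "real^'nu^'nu"
  assumes bounds_pos: "\<forall>i j. Ab $ i $ j > 0" "\<forall>i k. Bb $ i $ k > 0"
    and box: "\<forall>i j. \<bar>As $ i $ j - A $ i $ j\<bar> \<le> Ab $ i $ j"
             "\<forall>i k. \<bar>Bs $ i $ k - B $ i $ k\<bar> \<le> Bb $ i $ k"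
    and nonlin: "kb \<ge> 0" "\<forall>x1 x2. norm (ks x1 - ks x2) \<le> kb"
    and equilibrium: "\<exists>xd ud. yd = C *v xd \<and> As *v xd + ks xd = - (Bs *v ud)"
    and well_posed: "unique_solutions (closed_loop_rhs As Bs ks C yd Bc Cc Dc)"
    and opt: "optimal A B C Ab Bb \<alpha> \<zeta> \<kappa> \<mu> P Bc Cc Dc"
    and alpha_pos: "\<alpha> > 0"
  shows "practical_output_regulation As Bs ks C yd Bc Cc Dc (eps_c kb C \<alpha> \<zeta> P) \<and>
         (kb = 0 \<longrightarrow>
            exponentially_stable (closed_loop_rhs As Bs ks C yd Bc Cc Dc) \<and>
            (\<forall>x w. solution (closed_loop_rhs As Bs ks C yd Bc Cc Dc) (\<lambda>t. (x t, w t)) \<longrightarrow>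
                   ((\<lambda>t. C *v x t) \<longlongrightarrow> yd) at_top))"
proof -
  have feas: "feasible A B C Ab Bb \<alpha> \<zeta> \<kappa> \<mu> P Bc Cc Dc" using opt by (simp add: optimal_def)
  hence spd: "sym_pos_def P" and sym: "transpose P = P" and \<zeta>: "\<zeta> > 0"
    by (auto simp: feasible_def sym_pos_def_def)
  note lmin = lambda_min_pos[OF spd] and lmax = lambda_max_pos[OF spd]
  let ?f = "closed_loop_rhs As Bs ks C yd Bc Cc Dc"
  define L where "L = induced_norm (C_bar C :: real^('nx + 'nu)^('ny + 'nu))"
  have L: "0 \<le> L"
    unfolding L_def induced_norm_def by (rule onorm_pos_le[OF matrix_vector_mul_bounded_linear])
  define r where "r = \<alpha> / lambda_max P"
  have r: "r > 0" using alpha_pos lmax by (simp add: r_def)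
  define c where "c = \<zeta> * kb\<^sup>2 / r"
  obtain xd ud where eq1: "yd = C *v xd" "As *v xd + ks xd = - (Bs *v ud)" using equilibrium by blast
  obtain wd where eq2: "Cc *v wd = ud"
    using controller_output_surj[OF feas bounds_pos alpha_pos] by (metis surjD)
  define e where "e x w t = stack (x t - xd) (w t - wd)" for x and w and t :: real
  define h where "h x w t = c + exp (- r * t) * (e x w 0 \<bullet> (P *v e x w 0) - c)" for x w t
  have estimate: "(norm (e x w t))\<^sup>2 \<le> h x w t / lambda_min P"
    if "solution ?f (\<lambda>t. (x t, w t))" "t \<ge> 0" for x w t
    using closed_loop_estimate[OF feas alpha_pos bounds_pos box nonlin(2) eq1 eq2 that] lmin
    by (simp add: h_def e_def c_def r_def field_simps)
  have output_bound: "norm (C *v x t - yd) \<le> L * sqrt (h x w t / lambda_min P)"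
    if "solution ?f (\<lambda>t. (x t, w t))" "t \<ge> 0" for x w t
  proof -
    have "norm (C *v x t - yd) = norm (C *v (x t - xd))"
      by (simp add: eq1(1) matrix_vector_mult_diff_distrib)
    also have "\<dots> \<le> L * norm (e x w t)"
      unfolding L_def e_def by (rule output_le_induced_norm)
    also have "\<dots> \<le> L * sqrt (h x w t / lambda_min P)"
      using L real_le_rsqrt[OF estimate[OF that]] by (intro mult_left_mono) auto
    finally show ?thesis .
  qed
  have eps: "eps_c kb C \<alpha> \<zeta> P = L * sqrt (c / lambda_min P)"
  proof -
    have "c / lambda_min P = kb\<^sup>2 * (lambda_max P / (\<alpha> * inverse \<zeta> * lambda_min P))"
      using \<zeta> alpha_pos by (simp add: c_def r_def field_simps)
    thus ?thesis using nonlin(1)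
      by (simp only: eps_c_def L_def real_sqrt_mult real_sqrt_abs abs_of_nonneg mult_ac)
  qed
  have lim: "((\<lambda>t. L * sqrt (h x w t / lambda_min P)) \<longlongrightarrow> eps_c kb C \<alpha> \<zeta> P) at_top" for x w
  proof -
    have "((\<lambda>t. exp (- r * t)) \<longlongrightarrow> 0) at_top"
      using r by (intro filterlim_compose[OF exp_at_bot] filterlim_tendsto_neg_mult_at_bot[OF tendsto_const])
        (auto intro: filterlim_ident)
    hence "((\<lambda>t. h x w t) \<longlongrightarrow> c + 0 * (e x w 0 \<bullet> (P *v e x w 0) - c)) at_top"
      unfolding h_def by (intro tendsto_intros)
    thus ?thesis
      unfolding eps using lmin by (intro tendsto_intros) auto
  qed
  have regulation: "practical_output_regulation As Bs ks C yd Bc Cc Dc (eps_c kb C \<alpha> \<zeta> P)"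
    unfolding practical_output_regulation_def
  proof (intro allI impI conjI)
    fix x w assume sol: "solution ?f (\<lambda>t. (x t, w t))"
    define K where "K = (c + \<bar>e x w 0 \<bullet> (P *v e x w 0) - c\<bar>) / lambda_min P"
    have "norm (x t) \<le> norm xd + sqrt K" if "t \<ge> 0" for t
    proof -
      have "exp (- r * t) * (e x w 0 \<bullet> (P *v e x w 0) - c)
          \<le> exp (- r * t) * \<bar>e x w 0 \<bullet> (P *v e x w 0) - c\<bar>"
        by (intro mult_left_mono) auto
      also have "\<dots> \<le> 1 * \<bar>e x w 0 \<bullet> (P *v e x w 0) - c\<bar>"
        using r that by (intro mult_right_mono) auto
      finally have "h x w t / lambda_min P \<le> K"
        unfolding K_def h_def using lmin by (intro divide_right_mono) auto
      with estimate[OF sol that] have "norm (e x w t) \<le> sqrt K"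
        by (intro real_le_rsqrt) linarith
      moreover have "norm (x t - xd) \<le> norm (e x w t)"
        unfolding e_def norm_stack using norm_fst_le[of "x t - xd" "w t - wd"] by simp
      moreover have "norm (x t) \<le> norm xd + norm (x t - xd)"
        using norm_triangle_ineq[of xd "x t - xd"] by simp
      ultimately show ?thesis by linarith
    qed
    thus "bdd_above ((\<lambda>t. norm (x t)) ` {0..})"
      by (intro bdd_aboveI2[where M = "norm xd + sqrt K"]) auto
    have "Limsup at_top (\<lambda>t. ereal (norm (C *v x t - yd)))
        \<le> Limsup at_top (\<lambda>t. ereal (L * sqrt (h x w t / lambda_min P)))"
      by (rule Limsup_mono)
         (use output_bound[OF sol] in \<open>auto intro: eventually_mono[OF eventually_ge_at_top[of 0]]\<close>)
    also have "\<dots> = ereal (eps_c kb C \<alpha> \<zeta> P)"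
      by (intro lim_imp_Limsup tendsto_ereal lim) simp
    finally show "Limsup at_top (\<lambda>t. ereal (norm (C *v x t - yd))) \<le> ereal (eps_c kb C \<alpha> \<zeta> P)" .
  qed
  have stable: "exponentially_stable ?f" if "kb = 0"
    unfolding exponentially_stable_def
  proof (intro exI conjI allI impI)
    show "?f (xd, wd) = 0"
      by (simp add: closed_loop_error_dynamics[where ks=ks, OF eq1 eq2] zero_prod_def)
    show "0 < sqrt (lambda_max P / lambda_min P)" using lmin lmax by simp
    \<comment> \<open>The norm is comparable to the square root of \<open>V\<close>, so it decays at half the rate.\<close>
    show "0 < r / 2" using r by simp
    fix z t assume "solution ?f z" and t: "(0::real) \<le> t"
    hence sol: "solution ?f (\<lambda>t. (fst (z t), snd (z t)))" by simp
    define e0 where "e0 = e (\<lambda>t. fst (z t)) (\<lambda>t. snd (z t))"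
    have norm_e0: "norm (e0 s) = norm (z s - (xd, wd))" for s
      by (simp add: e0_def e_def norm_stack minus_prod_def)
    have "(norm (e0 t))\<^sup>2 \<le> exp (- r * t) * (e0 0 \<bullet> (P *v e0 0)) / lambda_min P"
      using estimate[OF sol t] that by (simp add: h_def c_def e0_def)
    also have "\<dots> \<le> exp (- r * t) * (lambda_max P * (norm (e0 0))\<^sup>2) / lambda_min P"
      using lmin by (intro divide_right_mono mult_left_mono quadratic_form_le_lambda_max[OF sym]) auto
    also have "\<dots> = (sqrt (lambda_max P / lambda_min P) * exp (- (r / 2) * t) * norm (e0 0))\<^sup>2"
      using lmin lmax by (simp add: power_mult_distrib exp_double[symmetric])
    finally show "norm (z t - (xd, wd)) \<le>
        sqrt (lambda_max P / lambda_min P) * exp (- (r / 2) * t) * norm (z 0 - (xd, wd))"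
      unfolding norm_e0 using lmin lmax by (simp add: power2_le_iff_abs_le)
  qed
  have "((\<lambda>t. C *v x t) \<longlongrightarrow> yd) at_top"
    if "kb = 0" and sol: "solution ?f (\<lambda>t. (x t, w t))" for x w
  proof -
    have "((\<lambda>t. L * sqrt (h x w t / lambda_min P)) \<longlongrightarrow> 0) at_top"
      using lim[of x w] that(1) by (simp add: eps_c_def)
    moreover have "\<forall>\<^sub>F t in at_top. norm (C *v x t - yd) \<le> L * sqrt (h x w t / lambda_min P)"
      using output_bound[OF sol] by (auto intro: eventually_mono[OF eventually_ge_at_top[of 0]])
    ultimately have "((\<lambda>t. C *v x t - yd) \<longlongrightarrow> 0) at_top" by (rule Lim_null_comparison[rotated])
    thus ?thesis by (simp add: LIM_zero_iff)
  qed
  with regulation stable show ?thesis by blast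
qed

end
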